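(* Let $q$ be a prime power of characteristic $p$, $r\geqslant1$, and let $d$ be a positive integer with $\gcd(d,p)=1$. Then the monomial $f(X)=X^d\in\mathbb{F}_{q^r}(X)$ belongs to $\mathcal{F}_d(q)$ if and only if $$d\notin\{1,2\}\cup\{p^k+1:~k=1,2,\ldots\}.$$
   Context: $\mathcal{F}_d(q)$ is the set of rational functions $f(X)\in\mathbb{F}_{q^r}(X)$ of degree $d$ such that for every $\omega\in\mathbb{F}_{q^r}^*$ the function $f(X+\omega)-f(X)$ is not of the form $\alpha(g(X)^p-g(X))+\beta X$ for any rational function $g(X)\in\overline{\mathbb{F}_q}(X)$ and any $\alpha,\beta\in\mathbb{F}_{q^r}$; here $\overline{\mathbb{F}_q}$ is the algebraic closure of $\mathbb{F}_q$. *)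

theory Defs
  imports "HOL-Algebra.Algebraic_Closure_Type"
begin

text \<open>
  The rational function field \<open>K(X)\<close> is the fraction field \<open>'a poly fract\<close> of the polynomial ring
  over \<open>K = 'a\<close>. For \<open>K\<close> a finite field with \<open>q ^ r\<close> elements, an algebraic closure of \<open>K\<close> is also
  an algebraic closure of its subfield with \<open>q\<close> elements, so \<open>'a alg_closure\<close> serves as the latter.
\<close>

definition rat_X :: "'a::field poly fract" where
  "rat_X = to_fract [:0, 1:]"

definition rat_const :: "'a::field \<Rightarrow> 'a poly fract" where
  "rat_const c = to_fract [:c:]"

text \<open>
  The degree of a rational function, read off from any representation in lowest terms
  (see \<open>rat_degree_Fract\<close> and \<open>ex_lowest_terms\<close> below).
\<close>

definition rat_degree :: "'a::field poly fract \<Rightarrow> nat" where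
  "rat_degree f = (THE n. \<exists>a b. b \<noteq> 0 \<and> coprime a b \<and> f = Fract a b \<and>
                          n = max (Polynomial.degree a) (Polynomial.degree b))"

text \<open>
  The map \<open>a / b \<mapsto> \<phi> a / \<phi> b\<close> of fraction fields induced by an injective ring homomorphism \<open>\<phi>\<close>
  (\<open>fract_lift_Fract\<close> below shows that such a map exists, i.e. that the description is not vacuous).
\<close>

definition fract_lift :: "('a::idom \<Rightarrow> 'b::idom) \<Rightarrow> 'a fract \<Rightarrow> 'b fract" where
  "fract_lift \<phi> f = (THE h. \<forall>a b. b \<noteq> 0 \<longrightarrow> f = Fract a b \<longrightarrow> h = Fract (\<phi> a) (\<phi> b))"

text \<open>The substitution \<open>f(X) \<mapsto> f(X + \<omega>)\<close>.\<close>

definition rat_shift :: "'a::field \<Rightarrow> 'a poly fract \<Rightarrow> 'a poly fract" where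
  "rat_shift \<omega> = fract_lift (\<lambda>a. pcompose a [:\<omega>, 1:])"

text \<open>The inclusion of \<open>K(X)\<close> into the rational function field over the algebraic closure.\<close>

definition rat_to_ac :: "'a::field poly fract \<Rightarrow> 'a alg_closure poly fract" where
  "rat_to_ac = fract_lift (map_poly to_ac)"

text \<open>
  The form \<open>\<alpha> (g\<^sup>p - g) + \<beta> X\<close>, with \<open>\<alpha>\<close>, \<open>\<beta>\<close> in \<open>K\<close> but \<open>g\<close> a rational function over the
  algebraic closure.
\<close>

definition AS_linear :: "'a::field poly fract \<Rightarrow> bool" where
  "AS_linear h \<longleftrightarrow> (\<exists>(g :: 'a alg_closure poly fract) (\<alpha>::'a) (\<beta>::'a).
     rat_to_ac h = rat_const (to_ac \<alpha>) * (g ^ CHAR('a) - g) + rat_const (to_ac \<beta>) * rat_X)"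

text \<open>
  The set \<open>\<F>\<^sub>d(q)\<close>; the field with \<open>q ^ r\<close> elements is the type \<open>'a\<close>, on which alone (and not on
  the way its cardinality is written as \<open>q ^ r\<close>) the defining condition depends.
\<close>

definition calF :: "nat \<Rightarrow> 'a::{field,finite} poly fract set" where
  "calF d = {f. rat_degree f = d \<and> (\<forall>\<omega>. \<omega> \<noteq> 0 \<longrightarrow> \<not> AS_linear (rat_shift \<omega> f - f))}"

lemma fract_lift_Fract:
  assumes "\<And>a b. \<phi> (a * b) = \<phi> a * \<phi> b" "\<And>a. \<phi> a = 0 \<longleftrightarrow> a = 0" "b \<noteq> 0"
  shows "fract_lift \<phi> (Fract a b) = Fract (\<phi> a) (\<phi> b)"
proof -
  have *: "Fract (\<phi> a) (\<phi> b) = Fract (\<phi> c) (\<phi> d)" if "d \<noteq> 0" "Fract a b = Fract c d" for c d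
  proof -
    have "a * d = c * b" using that assms(3) by (simp add: eq_fract)
    then have "\<phi> a * \<phi> d = \<phi> c * \<phi> b" by (simp flip: assms(1))
    then show ?thesis using that(1) assms(2,3) by (simp add: eq_fract)
  qed
  show ?thesis
    unfolding fract_lift_def
    by (rule the_equality) (use * assms(3) in \<open>blast+\<close>)
qed

lemma map_poly_to_ac_mult: "map_poly to_ac (a * b) = map_poly to_ac a * map_poly to_ac b"
  by (rule poly_eqI) (simp add: coeff_map_poly coeff_mult to_ac_sum)

lemma rat_shift_Fract:
  "b \<noteq> 0 \<Longrightarrow> rat_shift \<omega> (Fract a b) = Fract (pcompose a [:\<omega>, 1:]) (pcompose b [:\<omega>, 1:])"
  unfolding rat_shift_def
  by (rule fract_lift_Fract) (auto simp: pcompose_mult pcompose_eq_0_iff)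

lemma rat_to_ac_Fract:
  "b \<noteq> 0 \<Longrightarrow> rat_to_ac (Fract a b) = Fract (map_poly to_ac a) (map_poly to_ac b)"
  unfolding rat_to_ac_def
  by (rule fract_lift_Fract) (auto simp: map_poly_to_ac_mult map_poly_eq_0_iff)

lemma coprime_poly_bezout:
  fixes a b :: "'a::field poly"
  assumes "coprime a b"
  obtains u v where "u * a + v * b = 1"
proof -
  have "\<exists>u v. u * a + v * b = 1" using assms
  proof (induction "euclidean_size b" arbitrary: a b rule: less_induct)
    case less
    show ?case
    proof (cases "b = 0")
      case True
      then show ?thesis using less.prems by (auto elim!: dvdE) (metis mult.commute)
    next
      case False
      have "coprime b (a mod b)"
        using less.prems unfolding coprime_def by (metis dvd_mod_imp_dvd)
      from less.hyps[OF mod_size_less[OF False] this]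
      obtain u v where "u * b + v * (a mod b) = 1" by auto
      then have "v * a + (u - v * (a div b)) * b = 1"
        by (simp add: minus_div_mult_eq_mod[symmetric] algebra_simps)
      then show ?thesis by blast
    qed
  qed
  with that show ?thesis by blast
qed

lemma coprime_poly_dvd_cancel:
  fixes a b c :: "'a::field poly"
  assumes "coprime a b" "a dvd c * b"
  shows "a dvd c"
proof -
  obtain u v where "u * a + v * b = 1" using coprime_poly_bezout[OF assms(1)] .
  then have "c = (c * u) * a + v * (c * b)"
    by (metis distrib_left mult.assoc mult.left_commute mult.right_neutral)
  with assms(2) show ?thesis by (metis dvd_add dvd_mult dvd_triv_right)
qed

lemma rat_degree_Fract:
  fixes a b :: "'a::field poly"
  assumes "b \<noteq> 0" "coprime a b"
  shows "rat_degree (Fract a b) = max (Polynomial.degree a) (Polynomial.degree b)"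
  unfolding rat_degree_def
proof (rule the_equality)
  fix n assume "\<exists>c d. d \<noteq> 0 \<and> coprime c d \<and> Fract a b = Fract c d \<and>
    n = max (Polynomial.degree c) (Polynomial.degree d)"
  then obtain c d where *: "d \<noteq> 0" "coprime c d" "Fract a b = Fract c d"
    and n: "n = max (Polynomial.degree c) (Polynomial.degree d)" by blast
  have eq: "a * d = c * b" using * assms by (simp add: eq_fract)
  have "a dvd c" "c dvd a" "b dvd d" "d dvd b"
    using eq assms(2) *(2) coprime_poly_dvd_cancel[of a b c] coprime_poly_dvd_cancel[of c d a]
      coprime_poly_dvd_cancel[of b a d] coprime_poly_dvd_cancel[of d c b]
    by (metis coprime_commute dvd_triv_left dvd_triv_right mult.commute)+
  then have "Polynomial.degree a = Polynomial.degree c" "Polynomial.degree b = Polynomial.degree d"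
    using assms(1) *(1) by (metis dvd_0_left dvd_imp_degree_le order_antisym)+
  then show "n = max (Polynomial.degree a) (Polynomial.degree b)" using n by simp
qed (use assms in blast)

lemma ex_lowest_terms:
  fixes f :: "'a::field poly fract"
  obtains a b where "b \<noteq> 0" "coprime a b" "f = Fract a b"
proof -
  obtain a b where "f = Fract a b" "b \<noteq> 0" by (cases f)
  then have "\<exists>a b. b \<noteq> 0 \<and> coprime a b \<and> f = Fract a b"
  proof (induction "Polynomial.degree b" arbitrary: a b rule: less_induct)
    case less
    show ?case
    proof (cases "coprime a b")
      case False
      then obtain c where c: "c dvd a" "c dvd b" "\<not> is_unit c" by (auto elim: not_coprimeE)
      then obtain a' b' where ab: "a = c * a'" "b = c * b'" by (auto elim!: dvdE)
      with less.prems have "c \<noteq> 0" "b' \<noteq> 0" by auto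
      moreover have "Polynomial.degree c \<noteq> 0"
        using c(3) \<open>c \<noteq> 0\<close> by (simp add: is_unit_iff_degree)
      ultimately have "Polynomial.degree b' < Polynomial.degree b" "f = Fract a' b'"
        using ab less.prems by (auto simp: degree_mult_eq mult_fract_cancel)
      with less.hyps \<open>b' \<noteq> 0\<close> show ?thesis by blast
    qed (use less.prems in blast)
  qed
  with that show ?thesis by blast
qed

end

theory Submission
  imports Defs "HOL-Algebra.Exponent" "HOL-Number_Theory.Residues"
begin

text \<open>
  If \<open>d - 1 = p\<^sup>j m\<close> with \<open>m > 1\<close> prime to \<open>p\<close>, the coefficient of \<open>X\<^sup>n\<close> in
  \<open>(X + \<omega>)\<^sup>d - X\<^sup>d\<close>, for \<open>n = d - p\<^sup>j\<close>, is nonzero, \<open>n > 1\<close> is prime to \<open>p\<close>, and \<open>p n\<close> exceeds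
  the degree \<open>d - 1\<close>. In \<open>\<alpha>(g\<^sup>p - g) + \<beta>X\<close>, where \<open>g\<close> is necessarily a polynomial, such a term
  can only come from a term \<open>X\<^sup>n\<close> of \<open>g\<close>, so that the degree is at least \<open>p n\<close>, a contradiction.
  For the exceptional \<open>d\<close> the shift \<open>\<omega> = 1\<close> fails: for \<open>d = p\<^sup>k + 1\<close> the difference is
  \<open>X\<^bsup>p\<^sup>k\<^esup> + X + 1\<close>, and \<open>X\<^bsup>p\<^sup>k\<^esup> - X\<close> telescopes.
\<close>

section \<open>The characteristic of the field, and monomials as rational functions\<close>

lemma CHAR_eq_if_card_prime_power:
  assumes "prime p" "card (UNIV :: 'a::{field,finite} set) = p ^ n"
  shows "CHAR('a) = p"
proof -
  have "prime CHAR('a)"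
    by (intro prime_CHAR_semidom finite_imp_CHAR_pos) simp
  moreover have "CHAR('a) dvd p ^ n"
    using CHAR_dvd_CARD[where ?'a = 'a] assms(2) by simp
  ultimately show ?thesis
    using assms(1) prime_dvd_power primes_dvd_imp_eq by blast
qed

lemma to_fract_power: "to_fract (x ^ n) = to_fract x ^ n"
  by (induction n) auto

lemma rat_const_mult_to_fract: "rat_const c * to_fract u = to_fract (smult c u)"
  by (simp add: rat_const_def flip: to_fract_mult)

lemma rat_const_mult_rat_X: "rat_const c * rat_X = to_fract [:0, c:]"
  by (simp add: rat_X_def rat_const_mult_to_fract)

lemma rat_to_ac_to_fract: "rat_to_ac (to_fract h) = to_fract (map_poly to_ac h)"
  by (simp add: to_fract_def rat_to_ac_Fract)

lemma rat_shift_rat_X_power: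
  "rat_shift \<omega> (rat_X ^ d) - rat_X ^ d = to_fract ([:\<omega>, 1:] ^ d - [:0, 1:] ^ d)"
proof -
  have "pcompose ([:0, 1:] ^ d) [:\<omega>, 1:] = [:\<omega>, 1:] ^ d"
    by (induction d) (simp_all add: pcompose_1 pcompose_mult pcompose_pCons)
  then have "rat_shift \<omega> (rat_X ^ d) = to_fract ([:\<omega>, 1:] ^ d)"
    unfolding rat_X_def to_fract_power[symmetric] by (simp add: to_fract_def rat_shift_Fract pcompose_1)
  then show ?thesis
    by (simp add: rat_X_def to_fract_power)
qed

lemma rat_degree_rat_X_power: "rat_degree (rat_X ^ d :: 'a::field poly fract) = d"
proof -
  have "rat_X ^ d = Fract ([:0, 1:] ^ d :: 'a poly) 1"
    by (simp add: rat_X_def to_fract_power flip: to_fract_def)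
  then show ?thesis
    by (simp add: rat_degree_Fract degree_power_eq)
qed

section \<open>Reduction of the Artin-Schreier condition to polynomials\<close>

text \<open>The polynomial ring is integrally closed, and \<open>g\<close> is a root of the monic
  polynomial \<open>T^n - T - h\<close>. Concretely, clearing denominators in lowest terms shows
  that the denominator divides a power of the numerator, so it is a unit.\<close>

lemma fract_root_is_polynomial:
  fixes g :: "'a::field poly fract"
  assumes "n \<ge> 2" "g ^ n - g = to_fract h"
  obtains u where "g = to_fract u"
proof -
  obtain a b where ab: "b \<noteq> 0" "coprime a b" "g = Fract a b"
    by (rule ex_lowest_terms)
  define B where "B = to_fract b"
  have B: "B \<noteq> 0" "g * B = to_fract a"
    using ab by (simp_all add: B_def Fract_conv_to_fract)
  have n: "n = Suc (Suc (n - 2))"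
    using assms(1) by simp
  have "to_fract (a ^ n) = (g * B) ^ n"
    by (simp add: B to_fract_power)
  also have "\<dots> = (g ^ n - g) * B ^ n + g * B ^ n"
    by (simp add: power_mult_distrib algebra_simps)
  \<comment> \<open>Since n \<ge> 2, one factor \<open>B\<close> can clear the denominator of
    \<open>g\<close> while another stays visible; hence \<open>b\<close> divides both summands on
    the right.\<close>
  also have "g * B ^ n = (g * B) * B * B ^ (n - 2)"
    by (subst n) (simp add: algebra_simps)
  also have "(g ^ n - g) * B ^ n + \<dots> = to_fract (h * b ^ n + a * b * b ^ (n - 2))"
    unfolding B(2) assms(2) by (simp add: B_def to_fract_power)
  finally have "a ^ n = h * b ^ n + a * b * b ^ (n - 2)"
    by (simp only: to_fract_eq_iff)
  then have "b dvd a ^ n"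
    using assms(1) by (simp add: dvd_add dvd_mult dvd_power)
  moreover have "b dvd a ^ k \<Longrightarrow> b dvd 1" for k
  proof (induction k)
    case (Suc k)
    then have "b dvd a ^ k"
      using ab(2) coprime_poly_dvd_cancel[of b a "a ^ k"]
      by (simp add: coprime_commute mult.commute)
    then show ?case by (rule Suc.IH)
  qed simp
  ultimately obtain c where c: "1 = b * c"
    by (metis dvdE)
  have "g = to_fract (a * c)"
    using ab(1) c unfolding ab(3) to_fract_def by (simp add: eq_fract mult.assoc mult.commute)
  then show ?thesis by (rule that)
qed

text \<open>If \<alpha> is nonzero, dividing by it makes \<open>g ^ CHAR('a) - g\<close> a
  polynomial, which forces \<open>g\<close> to be one. If \<alpha> = 0, \<open>g\<close> may have
  poles but contributes nothing, and 0 replaces it.\<close>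

lemma AS_linear_to_fract_iff:
  fixes h :: "'a::field poly"
  assumes "prime CHAR('a)"
  shows "AS_linear (to_fract h) \<longleftrightarrow>
    (\<exists>g \<alpha> \<beta>. map_poly to_ac h = smult (to_ac \<alpha>) (g ^ CHAR('a) - g) + [:0, to_ac \<beta>:])"
    (is "?L \<longleftrightarrow> ?R")
proof
  assume ?R
  then obtain g \<alpha> \<beta>
    where "map_poly to_ac h = smult (to_ac \<alpha>) (g ^ CHAR('a) - g) + [:0, to_ac \<beta>:]"
    by blast
  then have "rat_to_ac (to_fract h) = rat_const (to_ac \<alpha>) *
      (to_fract g ^ CHAR('a) - to_fract g) + rat_const (to_ac \<beta>) * rat_X"
    by (simp add: rat_to_ac_to_fract rat_const_mult_rat_X rat_const_mult_to_fract
        flip: to_fract_power to_fract_diff)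
  then show ?L
    unfolding AS_linear_def by blast
next
  assume ?L
  then obtain g \<alpha> \<beta> where eq: "to_fract (map_poly to_ac h) = rat_const (to_ac \<alpha>) *
      (g ^ CHAR('a) - g) + to_fract [:0, to_ac \<beta>:]"
    unfolding AS_linear_def rat_to_ac_to_fract rat_const_mult_rat_X by blast
  show ?R
  proof (cases "\<alpha> = 0")
    case True
    then have "map_poly to_ac h = smult (to_ac 0) (0 ^ CHAR('a) - 0) + [:0, to_ac \<beta>:]"
      using eq by (simp add: rat_const_def)
    then show ?thesis by blast
  next
    case False
    define H where "H = map_poly to_ac h - [:0, to_ac \<beta>:]"
    have H: "to_fract H = rat_const (to_ac \<alpha>) * (g ^ CHAR('a) - g)"
      using eq by (simp add: H_def)
    have "to_fract (smult (inverse (to_ac \<alpha>)) H)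
        = rat_const (inverse (to_ac \<alpha>)) * rat_const (to_ac \<alpha>) * (g ^ CHAR('a) - g)"
      by (simp add: H mult.assoc flip: rat_const_mult_to_fract)
    also have "\<dots> = g ^ CHAR('a) - g"
      using False by (simp add: rat_const_def flip: to_fract_mult one_pCons)
    finally obtain u where u: "g = to_fract u"
      using fract_root_is_polynomial prime_ge_2_nat[OF assms] by metis
    have "H = smult (to_ac \<alpha>) (u ^ CHAR('a) - u)"
      using H unfolding u
      by (simp add: rat_const_mult_to_fract flip: to_fract_power to_fract_diff)
    then have "map_poly to_ac h = smult (to_ac \<alpha>) (u ^ CHAR('a) - u) + [:0, to_ac \<beta>:]"
      by (simp add: H_def algebra_simps)
    then show ?thesis by blast
  qed
qed

section \<open>Non-exceptional exponents: an obstruction by coefficients\<close>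

text \<open>A \<open>CHAR('a)\<close>-th power has derivative zero, so \<open>n\<close> times its
  coefficient at \<open>n\<close> vanishes, and \<open>n\<close> is invertible in the field.\<close>

lemma coeff_power_CHAR_eq_0:
  fixes g :: "'a::field poly"
  assumes "\<not> CHAR('a) dvd n"
  shows "Polynomial.coeff (g ^ CHAR('a)) n = 0"
proof (cases n)
  case (Suc k)
  have "pderiv (g ^ CHAR('a)) = 0"
    by (simp add: pderiv_power)
  then have "of_nat n * Polynomial.coeff (g ^ CHAR('a)) n = 0"
    using coeff_pderiv[of "g ^ CHAR('a)" k] Suc by simp
  then show ?thesis
    using assms by (simp add: of_nat_eq_0_iff_char_dvd)
qed (use assms in simp)

lemma not_AS_linear_if_coeff:
  fixes h :: "'a::field poly"
  assumes p: "prime CHAR('a)" and n: "n > 1" "\<not> CHAR('a) dvd n"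
    and h: "Polynomial.coeff h n \<noteq> 0" "Polynomial.degree h < CHAR('a) * n"
  shows "\<not> AS_linear (to_fract h)"
proof
  assume "AS_linear (to_fract h)"
  then obtain g \<alpha> \<beta>
    where eq: "map_poly to_ac h = smult (to_ac \<alpha>) (g ^ CHAR('a) - g) + [:0, to_ac \<beta>:]"
    unfolding AS_linear_to_fract_iff[OF p] by blast
  have lin: "Polynomial.coeff [:0, to_ac \<beta>:] i = 0" if "i > 1" for i
    using that by (simp add: coeff_eq_0)
  have "to_ac (Polynomial.coeff h n) = Polynomial.coeff (map_poly to_ac h) n"
    by (simp add: coeff_map_poly)
  also have "\<dots> = - to_ac \<alpha> * Polynomial.coeff g n"
    unfolding eq using n coeff_power_CHAR_eq_0[of n g] by (simp add: lin)
  finally have nz: "\<alpha> \<noteq> 0" "Polynomial.coeff g n \<noteq> 0"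
    using h(1) by auto
  \<comment> \<open>The contradiction is read off at the exponent \<open>CHAR('a) * D\<close>. It
    exceeds both 1 and the degree of \<open>g\<close>, so only the leading term of
    \<open>g ^ CHAR('a)\<close> contributes there; yet it also exceeds the degree of
    \<open>h\<close>.\<close>
  define D where "D = Polynomial.degree g"
  have D: "n \<le> D"
    unfolding D_def using nz(2) by (rule le_degree)
  with n(1) prime_gt_1_nat[OF p] have "D < CHAR('a) * D" by simp
  then have "Polynomial.coeff g (CHAR('a) * D) = 0"
    by (simp add: D_def coeff_eq_0)
  moreover have "Polynomial.degree (g ^ CHAR('a)) = CHAR('a) * D"
    using nz(2) by (subst degree_power_eq) (auto simp: D_def)
  then have "Polynomial.coeff (g ^ CHAR('a)) (CHAR('a) * D) \<noteq> 0"
    using nz(2) by (metis coeff_0 leading_coeff_0_iff power_not_zero)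
  moreover have "1 < CHAR('a) * D"
    using \<open>D < CHAR('a) * D\<close> D n(1) by linarith
  ultimately have "Polynomial.coeff (map_poly to_ac h) (CHAR('a) * D) \<noteq> 0"
    unfolding eq using nz(1) by (simp add: lin)
  moreover have "Polynomial.degree h < CHAR('a) * D"
    using h(2) D by (meson less_le_trans mult_le_mono2)
  ultimately show False
    by (simp add: coeff_map_poly coeff_eq_0)
qed

text \<open>The absorption identity, with \<open>N + 1\<close> prime to \<open>p\<close>, reduces
  the claim to \<open>N choose p ^ j\<close> for \<open>N = p ^ j * m\<close>. The multiplicity of
  \<open>p\<close> in that coefficient is the same as in \<open>m\<close>, namely zero; this is the
  count known from Sylow's theorem.\<close>

lemma prime_not_dvd_choose_prime_power:
  fixes p m j :: nat
  assumes p: "prime p" and m: "\<not> p dvd m" and cop: "coprime (p ^ j * m + 1) p"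
  shows "\<not> p dvd ((p ^ j * m + 1) choose p ^ j)"
proof
  define N where "N = p ^ j * m"
  assume "p dvd ((p ^ j * m + 1) choose p ^ j)"
  moreover have "(N + 1 - p ^ j) * ((N + 1) choose p ^ j) = (N + 1) * (N choose p ^ j)"
    using binomial_absorb_comp[of "N + 1" "p ^ j"] by simp
  ultimately have "p dvd (N + 1) * (N choose p ^ j)"
    unfolding N_def by (metis dvd_mult)
  then have "p dvd (N choose p ^ j)"
    using cop coprime_dvd_mult_right_iff[of p "N + 1"] unfolding N_def
    by (metis coprime_commute)
  moreover have "m > 0"
    using m by (intro gr0I) simp
  moreover have "multiplicity p (N choose p ^ j) = multiplicity p m"
    unfolding N_def using \<open>m > 0\<close> p by (rule const_p_fac)
  moreover have "N choose p ^ j \<noteq> 0"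
    using \<open>m > 0\<close> by (simp add: N_def)
  ultimately show False
    using p m by (metis multiplicity_eq_zero_iff not_dvd_imp_multiplicity_0 not_prime_unit)
qed

lemma not_AS_linear_shift:
  fixes \<omega> :: "'a::field"
  assumes p: "prime CHAR('a)" and "\<omega> \<noteq> 0" "d \<ge> 2" "coprime d CHAR('a)"
    and d: "\<And>k. d \<noteq> CHAR('a) ^ k + 1"
  shows "\<not> AS_linear (to_fract ([:\<omega>, 1:] ^ d - [:0, 1:] ^ d))"
proof -
  define p where "p = CHAR('a)"
  have "prime p" "p \<ge> 2"
    using p prime_ge_2_nat by (auto simp: p_def)
  define h where "h = [:\<omega>, 1:] ^ d - [:0, 1:] ^ d"
  obtain j m where jm: "d - 1 = p ^ j * m" "\<not> p dvd m"
    using multiplicity_decompose'[of "d - 1" p] \<open>d \<ge> 2\<close> \<open>prime p\<close>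
    by (metis One_nat_def diff_is_0_eq not_less_eq_eq numeral_2_eq_2 not_prime_unit)
  then have dm: "d = p ^ j * m + 1"
    using \<open>d \<ge> 2\<close> by simp
  \<comment> \<open>\<open>m = 1\<close> would give \<open>d = p ^ j + 1\<close>. Since
    \<open>j\<close> may be 0, the excluded exponents must include \<open>k = 0\<close>, that is,
    \<open>d = 2\<close>.\<close>
  have m: "m \<ge> 2"
    using dm d[of j] \<open>d \<ge> 2\<close> unfolding p_def[symmetric] by (cases "m = 0"; cases "m = 1") auto
  define n where "n = d - p ^ j"
  have n: "n = p ^ j * (m - 1) + 1" "n + p ^ j = d"
    using m by (cases m; simp add: n_def dm)+
  have coeff: "Polynomial.coeff h i = of_nat (d choose i) * \<omega> ^ (d - i)" if "i < d" for i
    using that unfolding h_def by (simp add: coeff_linear_poly_power)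
  \<comment> \<open>Here m \<ge> 2 is essential: it gives m \<le> p (m - 1), so \<open>p * n\<close>
    reaches \<open>d\<close> and lies above the degree of \<open>h\<close>, whose terms at
    \<open>d\<close> cancel.\<close>
  have "d \<le> p * n"
  proof -
    have "m \<le> 2 * (m - 1)" using m by simp
    also have "\<dots> \<le> p * (m - 1)" using \<open>p \<ge> 2\<close> by simp
    finally have "p ^ j * m \<le> p ^ j * (p * (m - 1))" by simp
    moreover have "p * n = p ^ j * (p * (m - 1)) + p"
      by (simp add: n algebra_simps)
    ultimately show ?thesis
      using \<open>p \<ge> 2\<close> unfolding dm by linarith
  qed
  moreover have "Polynomial.degree h \<le> d - 1"
  proof (rule degree_le, intro allI impI)
    fix i assume "d - 1 < i"
    then have "d \<le> i" by simp
    then show "Polynomial.coeff h i = 0"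
      by (cases "i = d") (simp_all add: h_def coeff_linear_power coeff_eq_0 degree_power_eq)
  qed
  ultimately have "Polynomial.degree h < p * n"
    using \<open>d \<ge> 2\<close> by simp
  moreover have "n > 1"
    using m \<open>p \<ge> 2\<close> by (simp add: n)
  moreover have "\<not> p dvd n"
  \<comment> \<open>For \<open>j = 0\<close> the exponent \<open>n\<close> is \<open>m\<close>
    itself; otherwise \<open>n\<close> is 1 modulo \<open>p\<close>.\<close>
  proof (cases "j = 0")
    case True
    then show ?thesis using n m jm dm by simp
  next
    case False
    then have "p dvd p ^ j * (m - 1)" by simp
    then show ?thesis
      unfolding n using \<open>p \<ge> 2\<close> by (metis dvd_add_right_iff nat_dvd_1_iff_1 numeral_le_one_iff semiring_norm(69))
  qed
  moreover have "Polynomial.coeff h n \<noteq> 0"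
  proof -
    have "n < d"
      using \<open>p \<ge> 2\<close> n(2)[symmetric] by simp
    moreover have "d choose n = d choose p ^ j"
      using n(2) binomial_symmetric[of n d] by (metis add_diff_cancel_left' le_add1)
    then have "\<not> p dvd (d choose n)"
      using prime_not_dvd_choose_prime_power[OF \<open>prime p\<close> jm(2)] assms(4)
      unfolding dm p_def by simp
    ultimately show ?thesis
      using coeff[of n] \<open>\<omega> \<noteq> 0\<close> by (simp add: of_nat_eq_0_iff_char_dvd p_def)
  qed
  ultimately show ?thesis
    using not_AS_linear_if_coeff[OF p] unfolding h_def p_def by blast
qed

section \<open>Exceptional exponents: explicit Artin-Schreier representations\<close>

text \<open>This absorbs the constant term 1 of the shifted difference into \<open>g^p - g\<close>;
  it is the reason for taking \<open>g\<close> over the algebraic closure, as the base field may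
  contain no such root.\<close>

lemma artin_schreier_root:
  fixes c :: "'a::alg_closed_field"
  assumes "n \<ge> 2"
  obtains x where "x ^ n - x = c"
proof -
  have "Polynomial.degree (Polynomial.monom 1 n + [:- c, -1:] :: 'a poly) = n"
    using assms by (subst degree_add_eq_left) (auto simp: degree_monom_eq)
  then obtain x where "poly (Polynomial.monom 1 n + [:- c, -1:] :: 'a poly) x = 0"
    using assms alg_closed_imp_poly_has_root[of "Polynomial.monom 1 n + [:- c, -1:] :: 'a poly"] by auto
  then show ?thesis
    by (intro that[of x]) (simp add: poly_monom algebra_simps)
qed

text \<open>In characteristic \<open>CHAR('a)\<close> the Frobenius map is additive and moves each
  summand to the next one.\<close>

lemma artin_schreier_telescope:
  fixes x :: "'a::comm_ring_1"
  assumes "prime CHAR('a)"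
  shows "(\<Sum>i<k. x ^ CHAR('a) ^ i) ^ CHAR('a) - (\<Sum>i<k. x ^ CHAR('a) ^ i) = x ^ CHAR('a) ^ k - x"
proof -
  have "(\<Sum>i<k. x ^ CHAR('a) ^ i) ^ CHAR('a) = (\<Sum>i<k. x ^ CHAR('a) ^ Suc i)"
    by (simp add: freshmans_dream_sum[OF assms] mult.commute flip: power_mult)
  then show ?thesis
    using sum_lessThan_telescope[of "\<lambda>i. x ^ CHAR('a) ^ i" k]
    by (simp add: sum_subtractf)
qed

lemma coeff_X_power:
  "Polynomial.coeff ([:0, 1 :: 'a::comm_semiring_1:] ^ n) i = (if i = n then 1 else 0)"
proof -
  have "[:0, 1 :: 'a:] ^ n = Polynomial.monom 1 n"
    by (simp add: monom_altdef)
  then show ?thesis by simp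
qed

text \<open>The witness is \<open>g = S + c\<close>, where \<open>S\<close> is the sum of
  \<open>X^(p^i)\<close> for \<open>i < k\<close> and \<open>c^p - c = 1\<close>. For
  \<open>k = 0\<close> the sum is empty and the exponent is \<open>d = 2\<close>.\<close>

lemma AS_linear_shift_prime_power_plus_1:
  assumes p: "prime CHAR('a::field)"
  shows "AS_linear (to_fract ([:1, 1:] ^ (CHAR('a) ^ k + 1) - [:0, 1:] ^ (CHAR('a) ^ k + 1) :: 'a poly))"
proof -
  define p where "p = CHAR('a)"
  define x :: "'a alg_closure poly" where "x = [:0, 1:]"
  obtain c :: "'a alg_closure" where c: "c ^ p - c = 1"
    using artin_schreier_root[of p 1] prime_ge_2_nat[OF p] unfolding p_def by blast
  define S where "S = (\<Sum>i<k. x ^ p ^ i)"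
  have S: "S ^ p - S = x ^ p ^ k - x"
    using artin_schreier_telescope[of x k] p unfolding S_def p_def by simp
  have "[:1, 1:] ^ (p ^ k + 1) - [:0, 1:] ^ (p ^ k + 1)
      = [:0, 1:] ^ p ^ k + ([:1, 1:] :: 'a poly)"
  proof -
    have "([:1, 1:] :: 'a poly) ^ p ^ k = (1 + [:0, 1:]) ^ p ^ k"
      by (simp add: one_pCons)
    also have "\<dots> = 1 + [:0, 1:] ^ p ^ k"
      using p by (subst freshmans_dream'[where n = k]) (simp_all add: p_def)
    finally show ?thesis
      by (simp add: algebra_simps one_pCons)
  qed
  moreover have "map_poly to_ac ([:0, 1:] ^ n + ([:1, 1:] :: 'a poly)) = x ^ n + x + 1" for n
    by (rule poly_eqI)
      (auto simp: x_def coeff_map_poly coeff_X_power coeff_pCons one_pCons split: nat.splits)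
  moreover have "(S + [:c:]) ^ p - (S + [:c:]) = x ^ p ^ k - x + 1"
  proof -
    have "(S + [:c:]) ^ p = S ^ p + [:c ^ p:]"
      using p by (subst freshmans_dream) (simp_all add: p_def poly_const_pow)
    also have "\<dots> - (S + [:c:]) = (S ^ p - S) + [:c ^ p - c:]"
      by simp
    finally show ?thesis
      unfolding S c by (simp add: one_pCons)
  qed
  \<comment> \<open>The telescoped sum supplies \<open>- X\<close> where the difference has
    \<open>+ X\<close>, so \<beta> = 2 makes up for both; in characteristic 2 this is zero.\<close>
  ultimately have "map_poly to_ac ([:1, 1:] ^ (p ^ k + 1) - [:0, 1:] ^ (p ^ k + 1))
      = smult (to_ac (1 :: 'a)) ((S + [:c:]) ^ p - (S + [:c:])) + [:0, to_ac (2 :: 'a):]"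
    by (simp add: x_def one_pCons)
  then show ?thesis
    unfolding AS_linear_to_fract_iff[OF p] p_def by blast
qed

text \<open>The difference is the constant 1, so a constant \<open>g\<close> with \<alpha> = 1 and
  \<beta> = 0 suffices.\<close>

lemma AS_linear_shift_1:
  assumes p: "prime CHAR('a::field)"
  shows "AS_linear (to_fract ([:1, 1:] ^ 1 - [:0, 1:] ^ 1 :: 'a poly))"
proof -
  obtain c :: "'a alg_closure" where "c ^ CHAR('a) - c = 1"
    using artin_schreier_root prime_ge_2_nat[OF p] by metis
  then have "map_poly to_ac ([:1, 1:] ^ 1 - [:0, 1:] ^ 1 :: 'a poly)
      = smult (to_ac 1) ([:c:] ^ CHAR('a) - [:c:]) + [:0, to_ac 0:]"
    by (simp add: poly_const_pow map_poly_pCons)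
  then show ?thesis
    unfolding AS_linear_to_fract_iff[OF p] by blast
qed

theorem theorem2p7:
  fixes p e q r d :: nat
  assumes "prime p" "e \<ge> 1" "q = p ^ e" "r \<ge> 1"
    and "card (UNIV :: 'a::{field,finite} set) = q ^ r"
    and "d \<ge> 1" "coprime d p"
  shows "(rat_X ^ d :: 'a poly fract) \<in> calF d \<longleftrightarrow>
           d \<notin> {1, 2} \<union> {p ^ k + 1 | k. k \<ge> 1}"
proof -
  have CHAR: "CHAR('a) = p"
    using assms(1,3,5) CHAR_eq_if_card_prime_power[of p "e * r"] by (simp add: power_mult)
  have p: "prime CHAR('a)"
    using assms(1) CHAR by simp
  have mem: "(rat_X ^ d :: 'a poly fract) \<in> calF d \<longleftrightarrow>
      (\<forall>\<omega>::'a. \<omega> \<noteq> 0 \<longrightarrow> \<not> AS_linear (to_fract ([:\<omega>, 1:] ^ d - [:0, 1:] ^ d)))"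
    by (simp add: calF_def rat_degree_rat_X_power rat_shift_rat_X_power)
  \<comment> \<open>The value 2 is \<open>p ^ 0 + 1\<close>, so it joins the family
    \<open>p ^ k + 1\<close> once \<open>k = 0\<close> is allowed.\<close>
  have exc: "d \<in> {1, 2} \<union> {p ^ k + 1 | k. k \<ge> 1} \<longleftrightarrow> d = 1 \<or> (\<exists>k. d = p ^ k + 1)"
  proof -
    have "(\<exists>k. d = p ^ k + 1) \<longleftrightarrow> d = p ^ 0 + 1 \<or> (\<exists>k\<ge>1. d = p ^ k + 1)"
      by (metis One_nat_def less_one not_le)
    then show ?thesis by auto
  qed
  show ?thesis
  proof (cases "d = 1 \<or> (\<exists>k. d = p ^ k + 1)")
    case True
    then have "AS_linear (to_fract ([:1, 1:] ^ d - [:0, 1:] ^ d :: 'a poly))"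
      using AS_linear_shift_1[OF p] AS_linear_shift_prime_power_plus_1[OF p]
      unfolding CHAR by blast
    then have "rat_X ^ d \<notin> (calF d :: 'a poly fract set)"
      unfolding mem by (metis zero_neq_one)
    with True exc show ?thesis by blast
  next
    case False
    then have "(rat_X ^ d :: 'a poly fract) \<in> calF d"
      unfolding mem using not_AS_linear_shift[OF p] assms(6,7) CHAR by auto
    with False exc show ?thesis by blast
  qed
qed

end
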